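(* For every $\alpha\in\mathbb{R}$, the Freund $4$-manifold $F$ has a constant $\alpha$-scalar curvature $$R^{(\alpha)}=\frac{-3(\alpha^2-1)}{2}.$$ In particular, $F$ has a positive scalar curvature $R^{(0)}=\frac32$ when $\alpha=0$. So geometrically it constitutes part of a sphere.
   Context: The Freund $4$-manifold $F$ is the family of Freund bivariate mixture exponential densities $$f(x,y;\alpha_1,\beta_1,\alpha_2,\beta_2)=\begin{cases}\alpha_1\beta_2\,e^{-\beta_2 y-(\alpha_1+\alpha_2-\beta_2)x} & 0\le x<y,\\ \alpha_2\beta_1\,e^{-\beta_1 x-(\alpha_1+\alpha_2-\beta_1)y} & 0\le y\le x,\end{cases}\qquad \alpha_i,\beta_i>0\ (i=1,2),$$ with coordinates $(x_1,x_2,x_3,x_4)=(\alpha_1,\beta_1,\alpha_2,\beta_2)$ and the Fisher information metric $g_{ij}=-\int_0^\infty\int_0^\infty \frac{\partial^2\log f}{\partial x_i\partial x_j}f\,dx\,dy$. The subscripted $\alpha_1,\alpha_2$ are coordinates, unrelated to the real number $\alpha$. With $\partial_i=\partial/\partial x_i$, the $\alpha$-connection $\nabla^{(\alpha)}$ is the torsion-free affine connection with $g(\nabla^{(\alpha)}_{\partial_i}\partial_j,\partial_k)=\Gamma^{(\alpha)}_{ij,k}$, where $$\Gamma^{(\alpha)}_{ij,k}=\int_0^\infty\!\!\int_0^\infty\Big(\partial_i\partial_j\log f\;\partial_k\log f+\tfrac{1-\alpha}{2}\,\partial_i\log f\,\partial_j\log f\,\partial_k\log f\Big)f\,dx\,dy.$$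 The $\alpha$-curvature tensor is the curvature of $\nabla^{(\alpha)}$, $R(X,Y)Z=\nabla_X\nabla_YZ-\nabla_Y\nabla_XZ-\nabla_{[X,Y]}Z$, with components $R^{(\alpha)}_{ijkl}=g(R(\partial_i,\partial_j)\partial_k,\partial_l)$; the $\alpha$-Ricci tensor is $R^{(\alpha)}_{jk}=\sum_{i,l}g^{il}R^{(\alpha)}_{ijkl}$ and the $\alpha$-scalar curvature is $R^{(\alpha)}=\sum_{j,k}g^{jk}R^{(\alpha)}_{jk}$, where $[g^{ij}]=[g_{ij}]^{-1}$.
   Formalization: "It constitutes part of a sphere" is false for a round 4-sphere, since F has planes of sectional curvature 0; it is replaced by the true statement that F is locally isometric to the product of a line and a round 3-sphere of radius 2. *)

theory Defs
  imports "HOL-Analysis.Analysis"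
begin

text \<open>
  A point \<open>p :: real^4\<close> carries the coordinates
  \<open>(p$1, p$2, p$3, p$4) = (\<alpha>\<^sub>1, \<beta>\<^sub>1, \<alpha>\<^sub>2, \<beta>\<^sub>2)\<close>. The manifold is covered by this single global chart,
  so vector fields are maps \<open>real^4 \<Rightarrow> real^4\<close>, the coordinate field \<open>\<partial>\<^sub>i\<close> being constant.
\<close>

definition Freund :: "(real^4) set" where
  "Freund = {p. \<forall>i. 0 < p $ i}"

definition freund_density :: "real^4 \<Rightarrow> real \<Rightarrow> real \<Rightarrow> real" where
  "freund_density p x y =
    (let \<alpha>1 = p $ 1; \<beta>1 = p $ 2; \<alpha>2 = p $ 3; \<beta>2 = p $ 4 in
      if 0 \<le> x \<and> x < y then \<alpha>1 * \<beta>2 * exp (- \<beta>2 * y - (\<alpha>1 + \<alpha>2 - \<beta>2) * x)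
      else if 0 \<le> y \<and> y \<le> x then \<alpha>2 * \<beta>1 * exp (- \<beta>1 * x - (\<alpha>1 + \<alpha>2 - \<beta>1) * y)
      else 0)"

definition log_density :: "real \<Rightarrow> real \<Rightarrow> real^4 \<Rightarrow> real" where
  "log_density x y p = ln (freund_density p x y)"

definition partial :: "4 \<Rightarrow> (real^4 \<Rightarrow> real) \<Rightarrow> real^4 \<Rightarrow> real" where
  "partial i h p = deriv (\<lambda>t. h (p + t *\<^sub>R axis i 1)) 0"

definition quadrant_integral :: "(real \<Rightarrow> real \<Rightarrow> real) \<Rightarrow> real" where
  "quadrant_integral h = (LBINT y:{0..}. (LBINT x:{0..}. h x y))"

definition fisher_metric :: "real^4 \<Rightarrow> real^4^4" where
  "fisher_metric p = (\<chi> i j. - quadrant_integral (\<lambda>x y.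
     partial i (partial j (log_density x y)) p * freund_density p x y))"

definition fisher_inner :: "real^4 \<Rightarrow> real^4 \<Rightarrow> real^4 \<Rightarrow> real" where
  "fisher_inner p u v = (\<Sum>i\<in>UNIV. \<Sum>j\<in>UNIV. fisher_metric p $ i $ j * u $ i * v $ j)"

definition inverse_metric :: "real^4 \<Rightarrow> real^4^4" where
  "inverse_metric p = matrix_inv (fisher_metric p)"

definition alpha_Gamma_lower :: "real \<Rightarrow> 4 \<Rightarrow> 4 \<Rightarrow> 4 \<Rightarrow> real^4 \<Rightarrow> real" where
  "alpha_Gamma_lower \<alpha> i j k p = quadrant_integral (\<lambda>x y.
     (partial i (partial j (log_density x y)) p * partial k (log_density x y) p
      + (1 - \<alpha>) / 2 * partial i (log_density x y) p * partial j (log_density x y) p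
          * partial k (log_density x y) p)
     * freund_density p x y)"

text \<open>
  Raising the last index solves \<open>g(\<nabla>\<^bsub>\<partial>i\<^esub> \<partial>\<^sub>j, \<partial>\<^sub>k) = \<Gamma>\<^bsub>ij,k\<^esub>\<close> for the components of
  \<open>\<nabla>\<^bsub>\<partial>i\<^esub> \<partial>\<^sub>j = \<Sum>\<^sub>m \<Gamma>\<^bsub>ij\<^esub>\<^sup>m \<partial>\<^sub>m\<close>.
\<close>

definition alpha_Gamma :: "real \<Rightarrow> 4 \<Rightarrow> 4 \<Rightarrow> 4 \<Rightarrow> real^4 \<Rightarrow> real" where
  "alpha_Gamma \<alpha> i j m p =
    (\<Sum>k\<in>UNIV. inverse_metric p $ m $ k * alpha_Gamma_lower \<alpha> i j k p)"

definition alpha_connection ::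
  "real \<Rightarrow> (real^4 \<Rightarrow> real^4) \<Rightarrow> (real^4 \<Rightarrow> real^4) \<Rightarrow> real^4 \<Rightarrow> real^4" where
  "alpha_connection \<alpha> X Y p = (\<chi> m. \<Sum>i\<in>UNIV. X p $ i *
     (partial i (\<lambda>q. Y q $ m) p + (\<Sum>j\<in>UNIV. Y p $ j * alpha_Gamma \<alpha> i j m p)))"

definition lie_bracket :: "(real^4 \<Rightarrow> real^4) \<Rightarrow> (real^4 \<Rightarrow> real^4) \<Rightarrow> real^4 \<Rightarrow> real^4" where
  "lie_bracket X Y p = (\<chi> m. \<Sum>i\<in>UNIV.
     X p $ i * partial i (\<lambda>q. Y q $ m) p - Y p $ i * partial i (\<lambda>q. X q $ m) p)"

definition alpha_curvature ::
  "real \<Rightarrow> (real^4 \<Rightarrow> real^4) \<Rightarrow> (real^4 \<Rightarrow> real^4) \<Rightarrow> (real^4 \<Rightarrow> real^4) \<Rightarrow> real^4 \<Rightarrow> real^4" where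
  "alpha_curvature \<alpha> X Y Z p =
     alpha_connection \<alpha> X (alpha_connection \<alpha> Y Z) p
     - alpha_connection \<alpha> Y (alpha_connection \<alpha> X Z) p
     - alpha_connection \<alpha> (lie_bracket X Y) Z p"

definition coord_field :: "4 \<Rightarrow> real^4 \<Rightarrow> real^4" where
  "coord_field i = (\<lambda>p. axis i 1)"

definition alpha_curvature_comp :: "real \<Rightarrow> 4 \<Rightarrow> 4 \<Rightarrow> 4 \<Rightarrow> 4 \<Rightarrow> real^4 \<Rightarrow> real" where
  "alpha_curvature_comp \<alpha> i j k l p =
     fisher_inner p (alpha_curvature \<alpha> (coord_field i) (coord_field j) (coord_field k) p)
       (coord_field l p)"

definition alpha_Ricci :: "real \<Rightarrow> 4 \<Rightarrow> 4 \<Rightarrow> real^4 \<Rightarrow> real" where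
  "alpha_Ricci \<alpha> j k p =
     (\<Sum>i\<in>UNIV. \<Sum>l\<in>UNIV. inverse_metric p $ i $ l * alpha_curvature_comp \<alpha> i j k l p)"

definition alpha_scalar_curvature :: "real \<Rightarrow> real^4 \<Rightarrow> real" where
  "alpha_scalar_curvature \<alpha> p =
     (\<Sum>j\<in>UNIV. \<Sum>k\<in>UNIV. inverse_metric p $ j $ k * alpha_Ricci \<alpha> j k p)"

text \<open>
  \<open>(Freund, g)\<close> is locally isometric to \<open>N\<close>, a submanifold of a Euclidean space with the induced
  metric: every point has a neighbourhood that some \<open>C\<^sup>1\<close> map \<open>\<Phi>\<close> sends bijectively onto a
  relatively open piece of \<open>N\<close>, pulling the Euclidean inner product back to \<open>g\<close>.
\<close>

definition Freund_locally_isometric_to :: "'b::euclidean_space set \<Rightarrow> bool" where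
  "Freund_locally_isometric_to N \<longleftrightarrow>
    (\<forall>p\<in>Freund. \<exists>U \<Phi> \<Phi>'. open U \<and> p \<in> U \<and> U \<subseteq> Freund \<and>
       inj_on \<Phi> U \<and> openin (top_of_set N) (\<Phi> ` U) \<and>
       (\<forall>v. continuous_on U (\<lambda>q. \<Phi>' q v)) \<and>
       (\<forall>q\<in>U. (\<Phi> has_derivative \<Phi>' q) (at q) \<and>
          (\<forall>v w. \<Phi>' q v \<bullet> \<Phi>' q w = fisher_inner q v w)))"

text \<open>
  The metric is that of the Riemannian product of a line, with coordinate \<open>ln (\<alpha>\<^sub>1 + \<alpha>\<^sub>2)\<close>, and an
  open piece of a round 3-sphere of radius 2 (so of scalar curvature \<open>6 / 2\<^sup>2 = 3/2\<close>), in Hopf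
  coordinates up to covering. It is not of constant sectional curvature, so the spherical part has
  to be this 3-dimensional factor and not a round 4-sphere.
\<close>

definition line_times_sphere :: "(real \<times> (real^4)) set" where
  "line_times_sphere = UNIV \<times> sphere 0 2"

end

theory Submission
  imports Defs "HOL-Probability.Distributions"
begin

text \<open>
  Under the Freund density \<open>min x y\<close> is exponential of rate \<open>s = \<alpha>\<^sub>1 + \<alpha>\<^sub>2\<close>, independently of which
  variable is the smaller one (\<open>x\<close> with probability \<open>\<alpha>\<^sub>1 / s\<close>); given that, the gap is exponential of
  rate \<open>\<beta>\<^sub>2\<close> or \<open>\<beta>\<^sub>1\<close>. The scores are affine in the minimum and the gap, so the metric, which is
  diagonal, and the connection coefficients are moments of degree at most three of two independent
  exponential variables, and the scalar curvature is the contraction of the resulting rational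
  functions.

  Putting \<open>\<alpha>\<^sub>1 = s cos\<^sup>2 \<theta>\<close> and \<open>\<alpha>\<^sub>2 = s sin\<^sup>2 \<theta>\<close> turns the metric into
  \<open>(d ln s)\<^sup>2 + 4 d\<theta>\<^sup>2 + cos\<^sup>2 \<theta> (d ln \<beta>\<^sub>2)\<^sup>2 + sin\<^sup>2 \<theta> (d ln \<beta>\<^sub>1)\<^sup>2\<close>, which is a line times a 3-sphere
  of radius 2 in Hopf coordinates with angles \<open>ln \<beta>\<^sub>2 / 2\<close> and \<open>ln \<beta>\<^sub>1 / 2\<close>.
\<close>

subsection \<open>Moments over the two branches\<close>

text \<open>Up to the factor \<open>1 / l\<close> the integrand is the exponential density
  \<open>erlang_density 0 l\<close> times \<open>z ^ n\<close>, whose moments are known. Whether 0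
  belongs to \<open>S\<close> does not matter, a point being a null set.\<close>

lemma nn_integral_power_exp:
  fixes l :: real
  assumes l: "0 < l" and S: "S = {0<..} \<or> S = {0..}"
  shows "(\<integral>\<^sup>+ z. ennreal (indicator S z * (z ^ n * exp (- l * z))) \<partial>lborel) = ennreal (fact n / l ^ Suc n)"
proof -
  have ae: "AE z in lborel. z \<noteq> (0::real)"
    by (rule AE_lborel_singleton)
  have "(\<integral>\<^sup>+ z. ennreal (indicator S z * (z ^ n * exp (- l * z))) \<partial>lborel)
      = (\<integral>\<^sup>+ z. ennreal (1 / l) * ennreal (erlang_density 0 l z * z ^ n) \<partial>lborel)"
    using ae
  proof (intro nn_integral_cong_AE, eventually_elim)
    fix z :: real assume "z \<noteq> 0"
    then have "indicator S z = indicat_real {0<..} z"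
      using S by (auto simp: indicator_def)
    then have "indicator S z * (z ^ n * exp (- l * z)) = 1 / l * (erlang_density 0 l z * z ^ n)"
      using l \<open>z \<noteq> 0\<close> by (auto simp: erlang_density_def indicator_def)
    then show "ennreal (indicator S z * (z ^ n * exp (- l * z)))
        = ennreal (1 / l) * ennreal (erlang_density 0 l z * z ^ n)"
      using l by (subst ennreal_mult'[symmetric]) auto
  qed
  also have "\<dots> = ennreal (1 / l) * ennreal (fact n / l ^ n)"
    using l by (subst nn_integral_cmult) (auto simp: nn_integral_erlang_ith_moment)
  also have "\<dots> = ennreal (fact n / l ^ Suc n)"
    using l by (subst ennreal_mult'[symmetric]) auto
  finally show ?thesis .
qed

text \<open>
  On a branch the pair \<open>(p, q)\<close> is the smaller and the larger of \<open>x\<close> and \<open>y\<close>. The set \<open>S\<close> of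
  admissible gaps is \<open>{0<..}\<close> on the branch \<open>x < y\<close> and \<open>{0..}\<close> on the branch \<open>y \<le> x\<close>.
\<close>

definition cone_weight ::
  "real set \<Rightarrow> real \<Rightarrow> real \<Rightarrow> (real \<Rightarrow> real \<Rightarrow> real) \<Rightarrow> real \<times> real \<Rightarrow> real" where
  "cone_weight S s d P = (\<lambda>(p, q). indicator {0..} p * indicator S (q - p)
     * (P p (q - p) * exp (- s * p - d * (q - p))))"

text \<open>The integrand is nonnegative, so Tonelli applies. For a fixed minimum \<open>p\<close>
  the translation \<open>q = p + z\<close> turns the larger variable into the gap, and the double
  integral factors into two one-dimensional moments.\<close>

lemma has_bochner_integral_cone_monomial:
  fixes s d :: real
  assumes s: "0 < s" and d: "0 < d" and S: "S = {0<..} \<or> S = {0..}"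
  shows "has_bochner_integral (lborel \<Otimes>\<^sub>M lborel) (cone_weight S s d (\<lambda>x z. x ^ m * z ^ n))
    (fact m * fact n / (s ^ Suc m * d ^ Suc n))"
proof (rule has_bochner_integral_nn_integral)
  have [measurable]: "S \<in> sets borel" using S by auto
  show meas: "cone_weight S s d (\<lambda>x z. x ^ m * z ^ n) \<in> borel_measurable (lborel \<Otimes>\<^sub>M lborel)"
    unfolding cone_weight_def by measurable
  show "AE x in lborel \<Otimes>\<^sub>M lborel. 0 \<le> cone_weight S s d (\<lambda>x z. x ^ m * z ^ n) x"
    using S by (intro AE_I2) (auto simp: cone_weight_def indicator_def)
  show "0 \<le> fact m * fact n / (s ^ Suc m * d ^ Suc n)" using s d by simp
  let ?f = "\<lambda>z. indicat_real S z * (z ^ n * exp (- d * z))"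
  let ?g = "\<lambda>p. indicat_real {0..} p * (p ^ m * exp (- s * p))"
  have "integral\<^sup>N (lborel \<Otimes>\<^sub>M lborel) (\<lambda>x. ennreal (cone_weight S s d (\<lambda>x z. x ^ m * z ^ n) x))
      = (\<integral>\<^sup>+ p. \<integral>\<^sup>+ q. ennreal (cone_weight S s d (\<lambda>x z. x ^ m * z ^ n) (p, q)) \<partial>lborel \<partial>lborel)"
    by (rule lborel.nn_integral_fst[symmetric]) (use meas in measurable)
  also have "\<dots> = (\<integral>\<^sup>+ p. ennreal (?g p) * ennreal (fact n / d ^ Suc n) \<partial>lborel)"
  proof (rule nn_integral_cong)
    fix p :: real
    have "(\<integral>\<^sup>+ q. ennreal (cone_weight S s d (\<lambda>x z. x ^ m * z ^ n) (p, q)) \<partial>lborel)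
        = (\<integral>\<^sup>+ q. ennreal (?g p) * ennreal (?f (q - p)) \<partial>lborel)"
    proof (rule nn_integral_cong)
      fix q :: real
      have "exp (- s * p - d * (q - p)) = exp (- s * p) * exp (- d * (q - p))"
        by (simp add: mult_exp_exp)
      then have "cone_weight S s d (\<lambda>x z. x ^ m * z ^ n) (p, q) = ?g p * ?f (q - p)"
        by (simp add: cone_weight_def)
      moreover have "0 \<le> ?g p" by (auto simp: indicator_def)
      ultimately show "ennreal (cone_weight S s d (\<lambda>x z. x ^ m * z ^ n) (p, q))
          = ennreal (?g p) * ennreal (?f (q - p))"
        by (simp only: ennreal_mult')
    qed
    also have "\<dots> = ennreal (?g p) * (\<integral>\<^sup>+ q. ennreal (?f (q - p)) \<partial>lborel)"
      by (rule nn_integral_cmult) measurable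
    also have "(\<integral>\<^sup>+ q. ennreal (?f (q - p)) \<partial>lborel) = (\<integral>\<^sup>+ q. ennreal (?f q) \<partial>lborel)"
      by (subst nn_integral_real_affine[where c = 1 and t = "p"]) auto
    also have "\<dots> = ennreal (fact n / d ^ Suc n)"
      by (rule nn_integral_power_exp[OF d S])
    finally show "(\<integral>\<^sup>+ q. ennreal (cone_weight S s d (\<lambda>x z. x ^ m * z ^ n) (p, q)) \<partial>lborel)
      = ennreal (?g p) * ennreal (fact n / d ^ Suc n)" .
  qed
  also have "\<dots> = (\<integral>\<^sup>+ p. ennreal (?g p) \<partial>lborel) * ennreal (fact n / d ^ Suc n)"
    by (rule nn_integral_multc) measurable
  also have "(\<integral>\<^sup>+ p. ennreal (?g p) \<partial>lborel) = ennreal (fact m / s ^ Suc m)"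
    by (rule nn_integral_power_exp[OF s]) simp
  also have "ennreal (fact m / s ^ Suc m) * ennreal (fact n / d ^ Suc n)
      = ennreal (fact m * fact n / (s ^ Suc m * d ^ Suc n))"
    using s d by (subst ennreal_mult'[symmetric]) (auto simp: field_simps)
  finally show "integral\<^sup>N (lborel \<Otimes>\<^sub>M lborel) (\<lambda>x. ennreal (cone_weight S s d (\<lambda>x z. x ^ m * z ^ n) x))
      = ennreal (fact m * fact n / (s ^ Suc m * d ^ Suc n))" .
qed

text \<open>
  The mean of \<open>\<Prod>\<^sub>i (u\<^sub>i + v\<^sub>i X + w\<^sub>i Z)\<close> for independent exponential \<open>X\<close>, \<open>Z\<close> of rates \<open>s\<close>, \<open>d\<close>, from
  \<open>E (X\<^sup>m Z\<^sup>n) = m! n! / (s\<^sup>m d\<^sup>n)\<close>.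
\<close>

definition affine_mean3 :: "real \<Rightarrow> real \<Rightarrow> real \<Rightarrow> real \<Rightarrow> real \<Rightarrow> real \<Rightarrow> real \<Rightarrow> real
    \<Rightarrow> real \<Rightarrow> real \<Rightarrow> real \<Rightarrow> real" where
  "affine_mean3 s d u1 v1 w1 u2 v2 w2 u3 v3 w3 =
     u1 * u2 * u3 + (u1 * u2 * v3 + u1 * v2 * u3 + v1 * u2 * u3) / s + (u1 * u2 * w3 + u1 * w2 * u3 + w1 * u2 * u3) / d
     + 2 * (u1 * v2 * v3 + v1 * u2 * v3 + v1 * v2 * u3) / s^2 + 2 * (u1 * w2 * w3 + w1 * u2 * w3 + w1 * w2 * u3) / d^2
     + (u1 * v2 * w3 + u1 * w2 * v3 + v1 * u2 * w3 + w1 * u2 * v3 + v1 * w2 * u3 + w1 * v2 * u3) / (s * d)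
     + 6 * (v1 * v2 * v3) / s^3 + 6 * (w1 * w2 * w3) / d^3
     + 2 * (v1 * v2 * w3 + v1 * w2 * v3 + w1 * v2 * v3) / (s^2 * d)
     + 2 * (v1 * w2 * w3 + w1 * v2 * w3 + w1 * w2 * v3) / (s * d^2)"

text \<open>The product expands into the ten monomials of degree at most three.
  \<open>cone_weight\<close> lacks the normalising factor \<open>s * d\<close> of the two
  exponential densities, hence the division.\<close>

lemma has_bochner_integral_cone_affine3:
  fixes s d :: real
  assumes s: "0 < s" and d: "0 < d" and S: "S = {0<..} \<or> S = {0..}"
  shows "has_bochner_integral (lborel \<Otimes>\<^sub>M lborel)
    (cone_weight S s d (\<lambda>x z. (u1 + v1 * x + w1 * z) * (u2 + v2 * x + w2 * z) * (u3 + v3 * x + w3 * z)))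
    (affine_mean3 s d u1 v1 w1 u2 v2 w2 u3 v3 w3 / (s * d))"
proof -
  note M = has_bochner_integral_cone_monomial[OF s d S]
  let ?W = "\<lambda>m n. cone_weight S s d (\<lambda>x z. x ^ m * z ^ n)"
  let ?M = "\<lambda>m n. fact m * fact n / (s ^ Suc m * d ^ Suc n) :: real"
  have "has_bochner_integral (lborel \<Otimes>\<^sub>M lborel) (\<lambda>t.
      u1 * u2 * u3 * ?W 0 0 t + (u1 * u2 * v3 + u1 * v2 * u3 + v1 * u2 * u3) * ?W 1 0 t
     + (u1 * u2 * w3 + u1 * w2 * u3 + w1 * u2 * u3) * ?W 0 1 t
     + (u1 * v2 * v3 + v1 * u2 * v3 + v1 * v2 * u3) * ?W 2 0 t + (u1 * w2 * w3 + w1 * u2 * w3 + w1 * w2 * u3) * ?W 0 2 t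
     + (u1 * v2 * w3 + u1 * w2 * v3 + v1 * u2 * w3 + w1 * u2 * v3 + v1 * w2 * u3 + w1 * v2 * u3) * ?W 1 1 t
     + (v1 * v2 * v3) * ?W 3 0 t + (w1 * w2 * w3) * ?W 0 3 t
     + (v1 * v2 * w3 + v1 * w2 * v3 + w1 * v2 * v3) * ?W 2 1 t
     + (v1 * w2 * w3 + w1 * v2 * w3 + w1 * w2 * v3) * ?W 1 2 t)
     (u1 * u2 * u3 * ?M 0 0 + (u1 * u2 * v3 + u1 * v2 * u3 + v1 * u2 * u3) * ?M 1 0
     + (u1 * u2 * w3 + u1 * w2 * u3 + w1 * u2 * u3) * ?M 0 1
     + (u1 * v2 * v3 + v1 * u2 * v3 + v1 * v2 * u3) * ?M 2 0 + (u1 * w2 * w3 + w1 * u2 * w3 + w1 * w2 * u3) * ?M 0 2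
     + (u1 * v2 * w3 + u1 * w2 * v3 + v1 * u2 * w3 + w1 * u2 * v3 + v1 * w2 * u3 + w1 * v2 * u3) * ?M 1 1
     + (v1 * v2 * v3) * ?M 3 0 + (w1 * w2 * w3) * ?M 0 3
     + (v1 * v2 * w3 + v1 * w2 * v3 + w1 * v2 * v3) * ?M 2 1
     + (v1 * w2 * w3 + w1 * v2 * w3 + w1 * w2 * v3) * ?M 1 2)" (is "has_bochner_integral _ ?F ?I")
    by (intro has_bochner_integral_add has_bochner_integral_mult_right M)
  moreover have "?F = cone_weight S s d (\<lambda>x z. (u1 + v1 * x + w1 * z) * (u2 + v2 * x + w2 * z) * (u3 + v3 * x + w3 * z))"
  proof
    fix t :: "real \<times> real"
    obtain p q where t: "t = (p, q)" by (cases t)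
    define z where "z = q - p"
    define e where "e = indicat_real {0..} p * indicator S z * exp (- s * p - d * z)"
    have W: "cone_weight S s d P t = P p z * e" for P
      by (simp add: t cone_weight_def z_def e_def)
    show "?F t = cone_weight S s d (\<lambda>x z. (u1 + v1 * x + w1 * z) * (u2 + v2 * x + w2 * z) * (u3 + v3 * x + w3 * z)) t"
      unfolding W by (simp add: algebra_simps power2_eq_square power3_eq_cube)
  qed
  moreover have "?I = affine_mean3 s d u1 v1 w1 u2 v2 w2 u3 v3 w3 / (s * d)"
    using s d by (simp add: affine_mean3_def add_divide_distrib power2_eq_square power3_eq_cube power4_eq_xxxx fact_numeral algebra_simps)
  ultimately show ?thesis by (simp only:)
qed

text \<open>The quadrant is the disjoint union of the two branches. Integrability on the product
  space is what allows Fubini to identify the iterated integral with the sum of the two cone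
  integrals.\<close>

lemma quadrant_integral_cones:
  assumes P: "has_bochner_integral (lborel \<Otimes>\<^sub>M lborel) (cone_weight {0<..} s d P) I"
    and Q: "has_bochner_integral (lborel \<Otimes>\<^sub>M lborel) (cone_weight {0..} s b Q) J"
    and h1: "\<And>x y. 0 \<le> x \<Longrightarrow> x < y \<Longrightarrow> h x y = A * (P x (y - x) * exp (- s * x - d * (y - x)))"
    and h2: "\<And>x y. 0 \<le> y \<Longrightarrow> y \<le> x \<Longrightarrow> h x y = B * (Q y (x - y) * exp (- s * y - b * (x - y)))"
  shows "quadrant_integral h = A * I + B * J"
proof -
  \<comment> \<open>Points are written \<open>(y, x)\<close>, outer variable first as in
    \<open>quadrant_integral\<close>. On the branch \<open>y \<le> x\<close> this already is
    (smaller, larger); on \<open>x < y\<close> the components have to be swapped.\<close>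
  have P': "has_bochner_integral (lborel \<Otimes>\<^sub>M lborel) (\<lambda>(x, y). cone_weight {0<..} s d P (y, x)) I"
    using P lborel_pair.integrable_product_swap[of "cone_weight {0<..} s d P"]
      lborel_pair.integral_product_swap[of "cone_weight {0<..} s d P"]
    by (auto simp: has_bochner_integral_iff)
  let ?G = "\<lambda>t. A * (case t of (x, y) \<Rightarrow> cone_weight {0<..} s d P (y, x)) + B * cone_weight {0..} s b Q t"
  have G: "has_bochner_integral (lborel \<Otimes>\<^sub>M lborel) ?G (A * I + B * J)"
    by (intro has_bochner_integral_add has_bochner_integral_mult_right P' Q)
  have "quadrant_integral h = (\<integral>y. \<integral>x. ?G (y, x) \<partial>lborel \<partial>lborel)"
    unfolding quadrant_integral_def set_lebesgue_integral_def
  proof (intro Bochner_Integration.integral_cong refl)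
    fix y :: real
    have "indicat_real {0..} y *\<^sub>R (LBINT x. indicat_real {0..} x *\<^sub>R h x y)
        = (LBINT x. indicat_real {0..} y * (indicat_real {0..} x * h x y))"
      by simp
    also have "\<dots> = (LBINT x. ?G (y, x))"
    proof (intro Bochner_Integration.integral_cong refl)
      fix x :: real
      show "indicat_real {0..} y * (indicat_real {0..} x * h x y) = ?G (y, x)"
        using h1[of x y] h2[of y x] by (auto simp: cone_weight_def indicator_def)
    qed
    finally show "indicat_real {0..} y *\<^sub>R (LBINT x. indicat_real {0..} x *\<^sub>R h x y) = (LBINT x. ?G (y, x))" .
  qed
  also have "\<dots> = integral\<^sup>L (lborel \<Otimes>\<^sub>M lborel) ?G"
    by (rule lborel_pair.integral_fst') (use G in \<open>simp add: has_bochner_integral_iff\<close>)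
  also have "\<dots> = A * I + B * J"
    using G by (simp add: has_bochner_integral_iff)
  finally show ?thesis .
qed

subsection \<open>Scores\<close>

lemma eventually_Freund_line:
  assumes "p \<in> Freund"
  shows "\<forall>\<^sub>F t in nhds 0. p + t *\<^sub>R axis i 1 \<in> Freund"
proof -
  have "\<forall>\<^sub>F t in nhds 0. p $ j + t * axis i 1 $ j > 0" for j
  proof -
    have "((\<lambda>t. p $ j + t * axis i 1 $ j) \<longlongrightarrow> p $ j + 0 * axis i 1 $ j) (nhds 0)"
      by (intro tendsto_intros filterlim_ident)
    then show ?thesis using assms by (intro order_tendstoD) (auto simp: Freund_def)
  qed
  then have "\<forall>\<^sub>F t in nhds 0. \<forall>j. p $ j + t * axis i 1 $ j > 0"
    by (intro eventually_all_finite)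
  then show ?thesis by eventually_elim (auto simp: Freund_def)
qed

text \<open>A derivative at \<open>p\<close> only sees values near \<open>p\<close>, and coordinate
  lines through \<open>p\<close> stay in \<open>Freund\<close> for small \<open>t\<close>. Hence a
  closed form valid only for positive parameters can be differentiated instead, also when
  \<open>h\<close> is itself a partial derivative.\<close>

lemma partial_eqI:
  assumes p: "p \<in> Freund" and h: "\<And>q. q \<in> Freund \<Longrightarrow> h q = h' q"
    and D: "((\<lambda>t. h' (p + t *\<^sub>R axis i 1)) has_real_derivative D) (at 0)"
  shows "partial i h p = D"
proof -
  have "\<forall>\<^sub>F t in nhds 0. h (p + t *\<^sub>R axis i 1) = h' (p + t *\<^sub>R axis i 1)"
    using eventually_Freund_line[OF p] by eventually_elim (rule h)
  then have "partial i h p = deriv (\<lambda>t. h' (p + t *\<^sub>R axis i 1)) 0"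
    unfolding partial_def by (rule deriv_cong_ev) simp
  with D show ?thesis by (simp add: DERIV_imp_deriv)
qed

text \<open>
  Both branches have the same shape: \<open>(e, g) = (1, 4)\<close> if \<open>x < y\<close> and \<open>(e, g) = (3, 2)\<close> if \<open>y \<le> x\<close>.
\<close>

definition log_branch :: "4 \<Rightarrow> 4 \<Rightarrow> real \<Rightarrow> real \<Rightarrow> real^4 \<Rightarrow> real" where
  "log_branch e g x z q = ln (q $ e) + ln (q $ g) - (q $ 1 + q $ 3) * x - q $ g * z"

lemma freund_density_branch:
  shows "0 \<le> x \<Longrightarrow> x < y \<Longrightarrow>
      freund_density q x y = q $ 1 * q $ 4 * exp (- (q $ 1 + q $ 3) * x - q $ 4 * (y - x))"
    and "0 \<le> y \<Longrightarrow> y \<le> x \<Longrightarrow>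
      freund_density q x y = q $ 3 * q $ 2 * exp (- (q $ 1 + q $ 3) * y - q $ 2 * (x - y))"
  by (auto simp: freund_density_def Let_def algebra_simps)

lemma log_density_branch:
  assumes "q \<in> Freund"
  shows "0 \<le> x \<Longrightarrow> x < y \<Longrightarrow> log_density x y q = log_branch 1 4 x (y - x) q"
    and "0 \<le> y \<Longrightarrow> y \<le> x \<Longrightarrow> log_density x y q = log_branch 3 2 y (x - y) q"
proof -
  have "q $ i > 0" "q $ i \<noteq> 0" for i
    using assms by (auto simp: Freund_def less_imp_neq[symmetric])
  then show "0 \<le> x \<Longrightarrow> x < y \<Longrightarrow> log_density x y q = log_branch 1 4 x (y - x) q"
    and "0 \<le> y \<Longrightarrow> y \<le> x \<Longrightarrow> log_density x y q = log_branch 3 2 y (x - y) q"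
    by (simp_all add: log_density_def freund_density_branch log_branch_def ln_mult algebra_simps)
qed

text \<open>The score is affine in the minimum and the gap: \<open>score_u\<close> is its constant
  term, \<open>score_v\<close> the coefficient of the minimum, \<open>score_w\<close> that of the
  gap. \<open>score_v\<close> is common to both branches because the minimum has the same rate on
  both. The Hessian is free of \<open>x\<close> and \<open>z\<close>, since these only multiply
  terms linear in the parameters.\<close>

definition "score_u e g p i = of_bool (i = e) / p $ e + of_bool (i = g) / p $ g" for p :: "real^4" and e g i :: 4
definition "score_v i = - of_bool (i = 1) - of_bool (i = 3)" for i :: 4
definition "score_w g i = - of_bool (i = g)" for g i :: 4
definition "branch_hess e g p i j = - of_bool (i = e \<and> j = e) / (p $ e)^2 - of_bool (i = g \<and> j = g) / (p $ g)^2"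
  for p :: "real^4" and e g i j :: 4

lemma axis_one_nth: "axis i (1::real) $ j = of_bool (i = j)"
  by (simp add: axis_def)

lemma partial_log_branch:
  assumes p: "p \<in> Freund" and h: "\<And>q. q \<in> Freund \<Longrightarrow> h q = log_branch e g x z q"
  shows "partial i h p = score_u e g p i + score_v i * x + score_w g i * z"
proof (rule partial_eqI[OF p h])
  have pos: "p $ e > 0" "p $ g > 0" using p by (auto simp: Freund_def)
  show "((\<lambda>t. log_branch e g x z (p + t *\<^sub>R axis i 1)) has_real_derivative
      score_u e g p i + score_v i * x + score_w g i * z) (at 0)"
    unfolding log_branch_def vector_add_component vector_scaleR_component
    using pos by (auto intro!: derivative_eq_intros
      simp: axis_one_nth score_u_def score_v_def score_w_def algebra_simps)
qed

lemma partial2_log_branch: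
  assumes p: "p \<in> Freund" and h: "\<And>q. q \<in> Freund \<Longrightarrow> h q = log_branch e g x z q"
  shows "partial i (partial j h) p = branch_hess e g p i j"
proof (rule partial_eqI[OF p partial_log_branch[OF _ h]])
  have pos: "p $ e > 0" "p $ g > 0" using p by (auto simp: Freund_def)
  show "((\<lambda>t. score_u e g (p + t *\<^sub>R axis i 1) j + score_v j * x + score_w g j * z) has_real_derivative
      branch_hess e g p i j) (at 0)"
    unfolding score_u_def vector_add_component vector_scaleR_component
    using pos by (auto intro!: derivative_eq_intros simp: axis_one_nth branch_hess_def power2_eq_square)
qed

subsection \<open>Metric and connection coefficients\<close>

text \<open>This is the conditional expectation, given the branch, of the expression defining the
  lowered coefficient, with \<open>\<kappa>\<close> standing for \<open>(1 - \<alpha>) / 2\<close>.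
  In the first summand the constant Hessian and the constant 1 count as affine factors, so that the
  same cubic moment formula serves both summands.\<close>

definition branch_Gamma :: "real \<Rightarrow> 4 \<Rightarrow> 4 \<Rightarrow> real^4 \<Rightarrow> 4 \<Rightarrow> 4 \<Rightarrow> 4 \<Rightarrow> real" where
  "branch_Gamma \<kappa> e g p i j k =
     affine_mean3 (p $ 1 + p $ 3) (p $ g) (branch_hess e g p i j) 0 0 1 0 0
        (score_u e g p k) (score_v k) (score_w g k)
     + \<kappa> * affine_mean3 (p $ 1 + p $ 3) (p $ g) (score_u e g p i) (score_v i) (score_w g i)
        (score_u e g p j) (score_v j) (score_w g j) (score_u e g p k) (score_v k) (score_w g k)"

lemma Freund_pos:
  assumes "p \<in> Freund"
  shows "0 < p $ i" "p $ i \<noteq> 0" "0 < p $ i + p $ j" "p $ i + p $ j \<noteq> 0"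
  using assms by (auto simp: Freund_def add_pos_pos less_imp_neq[symmetric])

lemma cone_weight_add:
  "cone_weight S s d P t + k * cone_weight S s d Q t = cone_weight S s d (\<lambda>x z. P x z + k * Q x z) t"
  by (cases t) (simp add: cone_weight_def algebra_simps)

text \<open>Total expectation over the branches, whose probabilities are
  \<open>p $ 1 / (p $ 1 + p $ 3)\<close> and \<open>p $ 3 / (p $ 1 + p $ 3)\<close>: the gap rate in
  the density cancels against that in the cone integral.\<close>

lemma alpha_Gamma_lower_branches:
  assumes p: "p \<in> Freund"
  shows "alpha_Gamma_lower \<alpha> i j k p =
    (p $ 1 * branch_Gamma ((1 - \<alpha>) / 2) 1 4 p i j k + p $ 3 * branch_Gamma ((1 - \<alpha>) / 2) 3 2 p i j k)
      / (p $ 1 + p $ 3)"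
proof -
  let ?s = "p $ 1 + p $ 3" and ?k = "(1 - \<alpha>) / 2"
  let ?l = "\<lambda>e g i x z. score_u e g p i + score_v i * x + score_w g i * z"
  let ?P = "\<lambda>e g x z. branch_hess e g p i j * ?l e g k x z + ?k * (?l e g i x z * ?l e g j x z * ?l e g k x z)"
  have B: "has_bochner_integral (lborel \<Otimes>\<^sub>M lborel) (cone_weight S ?s (p $ g) (?P e g))
      (branch_Gamma ?k e g p i j k / (?s * p $ g))"
    if S: "S = {0<..} \<or> S = {0..}" for S e g
  proof -
    note C = has_bochner_integral_cone_affine3[OF Freund_pos(3)[OF p] Freund_pos(1)[OF p] S]
    have "has_bochner_integral (lborel \<Otimes>\<^sub>M lborel)
        (\<lambda>t. cone_weight S ?s (p $ g) (\<lambda>x z. (branch_hess e g p i j + 0 * x + 0 * z) * (1 + 0 * x + 0 * z)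
            * ?l e g k x z) t
          + ?k * cone_weight S ?s (p $ g) (\<lambda>x z. ?l e g i x z * ?l e g j x z * ?l e g k x z) t)
        (branch_Gamma ?k e g p i j k / (?s * p $ g))"
      unfolding branch_Gamma_def add_divide_distrib times_divide_eq_right[symmetric]
      by (intro has_bochner_integral_add has_bochner_integral_mult_right C)
    then show ?thesis
      by (simp only: cone_weight_add mult_zero_left add_0_right mult_1_right)
  qed
  have "alpha_Gamma_lower \<alpha> i j k p =
      (p $ 1 * p $ 4) * (branch_Gamma ?k 1 4 p i j k / (?s * p $ 4))
      + (p $ 3 * p $ 2) * (branch_Gamma ?k 3 2 p i j k / (?s * p $ 2))"
    unfolding alpha_Gamma_lower_def
    by (rule quadrant_integral_cones[OF B B])
      (simp_all add: freund_density_branch partial_log_branch[OF p log_density_branch(1)]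
        partial_log_branch[OF p log_density_branch(2)]
        partial2_log_branch[OF p log_density_branch(1)] partial2_log_branch[OF p log_density_branch(2)])
  also have "\<dots> = (p $ 1 * branch_Gamma ?k 1 4 p i j k + p $ 3 * branch_Gamma ?k 3 2 p i j k) / ?s"
    using Freund_pos[OF p] by (simp add: add_divide_distrib)
  finally show ?thesis .
qed

definition metric_diag :: "real^4 \<Rightarrow> real^4" where
  "metric_diag p = (\<chi> i. (if i = 1 then 1 / p $ 1 else if i = 2 then p $ 3 / (p $ 2)\<^sup>2
     else if i = 3 then 1 / p $ 3 else p $ 1 / (p $ 4)\<^sup>2) / (p $ 1 + p $ 3))"

lemma metric_diag_nth:
  "metric_diag p $ 1 = 1 / (p $ 1 * (p $ 1 + p $ 3))"
  "metric_diag p $ 2 = p $ 3 / ((p $ 2)\<^sup>2 * (p $ 1 + p $ 3))"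
  "metric_diag p $ 3 = 1 / (p $ 3 * (p $ 1 + p $ 3))"
  "metric_diag p $ 4 = p $ 1 / ((p $ 4)\<^sup>2 * (p $ 1 + p $ 3))"
  by (simp_all add: metric_diag_def)

lemma metric_diag_nonzero:
  assumes "p \<in> Freund" shows "metric_diag p $ i \<noteq> 0"
  using exhaust_4[of i] Freund_pos[OF assms] by (auto simp: metric_diag_nth)

text \<open>On each branch the log-density is a sum of functions of single parameters, so mixed
  second derivatives vanish. A diagonal entry is minus the Hessian entry weighted by the probability
  of the branch in which it occurs.\<close>

lemma fisher_metric_diag:
  assumes p: "p \<in> Freund"
  shows "fisher_metric p = (\<chi> i j. if i = j then metric_diag p $ i else 0)"
proof -
  let ?s = "p $ 1 + p $ 3"
  have B: "has_bochner_integral (lborel \<Otimes>\<^sub>M lborel) (cone_weight S ?s (p $ g) (\<lambda>x z. branch_hess e g p i j))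
      (branch_hess e g p i j / (?s * p $ g))"
    if S: "S = {0<..} \<or> S = {0..}" for S e g i j
    using has_bochner_integral_cone_affine3[OF Freund_pos(3)[OF p, of 1 3] Freund_pos(1)[OF p, of g] S,
        of "branch_hess e g p i j" 0 0 1 0 0 1 0 0]
    by (simp add: affine_mean3_def)
  have "fisher_metric p $ i $ j = -((p $ 1 * p $ 4) * (branch_hess 1 4 p i j / (?s * p $ 4))
      + (p $ 3 * p $ 2) * (branch_hess 3 2 p i j / (?s * p $ 2)))" for i j
    unfolding fisher_metric_def vec_lambda_beta neg_equal_iff_equal
    by (rule quadrant_integral_cones[OF B B])
      (simp_all add: freund_density_branch partial2_log_branch[OF p log_density_branch(1)]
        partial2_log_branch[OF p log_density_branch(2)])
  then show ?thesis
    using Freund_pos[OF p]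
    by (simp add: vec_eq_iff forall_4 branch_hess_def metric_diag_nth power2_eq_square)
qed

section \<open>The inverse metric and the coefficients with raised index\<close>

lemma matrix_inv_eqI:
  fixes A B :: "real^'n^'n"
  assumes AB: "A ** B = mat 1" and BA: "B ** A = mat 1"
  shows "matrix_inv A = B"
proof -
  have inv: "A ** matrix_inv A = mat 1 \<and> matrix_inv A ** A = mat 1"
    unfolding matrix_inv_def by (rule someI[of _ B]) (use AB BA in simp)
  then have "matrix_inv A = matrix_inv A ** (A ** B)" by (simp add: AB)
  also have "\<dots> = B" using inv by (simp add: matrix_mul_assoc)
  finally show ?thesis .
qed

lemma inverse_metric_diag:
  assumes p: "p \<in> Freund"
  shows "inverse_metric p = (\<chi> i j. if i = j then 1 / metric_diag p $ i else 0)"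
proof -
  have eq: "(if b then x else 0) * y = (if b then x * y else 0)" "y * (if b then x else 0) = (if b then y * x else 0)"
    for b and x y :: real by auto
  show ?thesis
    unfolding inverse_metric_def fisher_metric_diag[OF p]
    by (rule matrix_inv_eqI)
      (auto simp: matrix_matrix_mult_def mat_def vec_eq_iff eq metric_diag_nonzero[OF p] cong: if_cong)
qed

text \<open>The closed form of the coefficients, needed because the curvature differentiates them;
  again \<open>\<kappa>\<close> is \<open>(1 - \<alpha>) / 2\<close>. The table is symmetric in
  \<open>i\<close> and \<open>j\<close>, and invariant under exchanging the indices 1 with 3 and 2
  with 4, which reflects the exchange of \<open>x\<close> and \<open>y\<close>.\<close>

definition Freund_Gamma :: "real \<Rightarrow> 4 \<Rightarrow> 4 \<Rightarrow> 4 \<Rightarrow> real^4 \<Rightarrow> real" where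
  "Freund_Gamma \<kappa> i j m p = (let a = p $ 1; b = p $ 2; c = p $ 3; d = p $ 4; s = a + c in
     if i = 1 \<and> j = 1 \<and> m = 1 then (\<kappa> * (c - 2 * a) - c) / (a * s)
     else if i = 1 \<and> j = 1 \<and> m = 3 then (1 - \<kappa>) * c / (a * s)
     else if i = 3 \<and> j = 3 \<and> m = 3 then (\<kappa> * (a - 2 * c) - a) / (c * s)
     else if i = 3 \<and> j = 3 \<and> m = 1 then (1 - \<kappa>) * a / (c * s)
     else if (i = 1 \<and> j = 3 \<or> i = 3 \<and> j = 1) \<and> (m = 1 \<or> m = 3) then - \<kappa> / s
     else if i = 4 \<and> j = 4 \<and> m = 1 then (\<kappa> - 1) * a * c / (s * d\<^sup>2)
     else if i = 4 \<and> j = 4 \<and> m = 3 then (1 - \<kappa>) * a * c / (s * d\<^sup>2)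
     else if i = 4 \<and> j = 4 \<and> m = 4 then - 2 * \<kappa> / d
     else if (i = 1 \<and> j = 4 \<or> i = 4 \<and> j = 1) \<and> m = 4 then \<kappa> * c / (a * s)
     else if (i = 3 \<and> j = 4 \<or> i = 4 \<and> j = 3) \<and> m = 4 then - \<kappa> / s
     else if i = 2 \<and> j = 2 \<and> m = 1 then (1 - \<kappa>) * a * c / (s * b\<^sup>2)
     else if i = 2 \<and> j = 2 \<and> m = 3 then (\<kappa> - 1) * a * c / (s * b\<^sup>2)
     else if i = 2 \<and> j = 2 \<and> m = 2 then - 2 * \<kappa> / b
     else if (i = 1 \<and> j = 2 \<or> i = 2 \<and> j = 1) \<and> m = 2 then - \<kappa> / s
     else if (i = 3 \<and> j = 2 \<or> i = 2 \<and> j = 3) \<and> m = 2 then \<kappa> * a / (c * s)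
     else 0)"

lemma alpha_Gamma_eq_raise:
  assumes p: "p \<in> Freund"
  shows "alpha_Gamma \<alpha> i j m p = alpha_Gamma_lower \<alpha> i j m p / metric_diag p $ m"
  by (simp add: alpha_Gamma_def inverse_metric_diag[OF p] if_distrib[of "\<lambda>x. x * _"] cong: if_cong)

lemma alpha_Gamma_Freund:
  assumes p: "p \<in> Freund"
  shows "alpha_Gamma \<alpha> i j m p = Freund_Gamma ((1 - \<alpha>) / 2) i j m p"
proof -
  define \<kappa> where "\<kappa> = (1 - \<alpha>) / 2"
  define a b c d s where "a = p $ 1" "b = p $ 2" "c = p $ 3" "d = p $ 4" "s = a + c"
  note abcds = this
  have nz: "a \<noteq> 0" "b \<noteq> 0" "c \<noteq> 0" "d \<noteq> 0" "s \<noteq> 0"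
    using Freund_pos[OF p] by (auto simp: abcds)
  have eqs: "p $ 1 = a" "p $ 2 = b" "p $ 3 = c" "p $ 4 = d" "a + c = s"
    by (auto simp: abcds)
  \<comment> \<open>Denominators are cleared with \<open>a\<close>, \<open>c\<close> and
    \<open>s\<close> kept as atoms. Eliminating \<open>c\<close> afterwards reduces whatever is left
    of the 64 cases to polynomial identities.\<close>
  have c: "c = s - a" by (simp add: abcds)
  have "\<forall>i j m. (a * branch_Gamma \<kappa> 1 4 p i j m + c * branch_Gamma \<kappa> 3 2 p i j m) / s
      / metric_diag p $ m = Freund_Gamma \<kappa> i j m p"
    unfolding forall_4
    by (intro conjI; simp add: branch_Gamma_def affine_mean3_def score_u_def score_v_def score_w_def branch_hess_def
        metric_diag_nth Freund_Gamma_def Let_def eqs;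
      (simp add: nz divide_simps)?; (simp add: c eval_nat_numeral algebra_simps; fail)?)
  then show ?thesis
    by (simp add: alpha_Gamma_eq_raise[OF p] alpha_Gamma_lower_branches[OF p] eqs \<kappa>_def[symmetric])
qed

subsection \<open>Curvature\<close>

lemma partial_const [simp]: "partial i (\<lambda>q. c) p = 0"
  by (simp add: partial_def)

lemma sum_axis [simp]: "(\<Sum>i\<in>UNIV. axis j (1::real) $ i * f i) = f j"
  by (simp add: axis_def if_distrib[of "\<lambda>x. x * _"] cong: if_cong)

lemma alpha_connection_coord:
  "alpha_connection \<alpha> (coord_field j) (coord_field k) = (\<lambda>q. \<chi> m. alpha_Gamma \<alpha> j k m q)"
  by (simp add: alpha_connection_def coord_field_def fun_eq_iff)

text \<open>Coordinate fields are constant, so they commute and the bracket term drops; only the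
  connection coefficients get differentiated.\<close>

lemma alpha_curvature_coord:
  "alpha_curvature \<alpha> (coord_field i) (coord_field j) (coord_field k) p $ m =
     partial i (alpha_Gamma \<alpha> j k m) p - partial j (alpha_Gamma \<alpha> i k m) p
     + (\<Sum>l\<in>UNIV. alpha_Gamma \<alpha> j k l p * alpha_Gamma \<alpha> i l m p
        - alpha_Gamma \<alpha> i k l p * alpha_Gamma \<alpha> j l m p)"
proof -
  have "lie_bracket (coord_field i) (coord_field j) = (\<lambda>q. 0)"
    by (simp add: lie_bracket_def coord_field_def fun_eq_iff vec_eq_iff)
  then have 0: "alpha_connection \<alpha> (lie_bracket (coord_field i) (coord_field j)) Z p = 0" for Z
    by (simp add: alpha_connection_def vec_eq_iff)
  show ?thesis
    unfolding alpha_curvature_def alpha_connection_coord 0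
    by (simp add: alpha_connection_def coord_field_def sum_subtractf)
qed

text \<open>Lowering the last index by the metric and contracting it with the inverse metric cancel,
  which leaves a trace.\<close>

lemma alpha_Ricci_contraction:
  assumes p: "p \<in> Freund"
  shows "alpha_Ricci \<alpha> j k p =
    (\<Sum>i\<in>UNIV. alpha_curvature \<alpha> (coord_field i) (coord_field j) (coord_field k) p $ i)"
proof -
  have "alpha_curvature_comp \<alpha> i j k l p =
      metric_diag p $ l * alpha_curvature \<alpha> (coord_field i) (coord_field j) (coord_field k) p $ l" for i l
    by (simp add: alpha_curvature_comp_def fisher_inner_def fisher_metric_diag[OF p] coord_field_def
        axis_def if_distrib[of "\<lambda>x. x * _"] if_distrib[of "\<lambda>x. _ * x"] cong: if_cong)
  then show ?thesis
    using metric_diag_nonzero[OF p]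
    by (simp add: alpha_Ricci_def inverse_metric_diag[OF p] if_distrib[of "\<lambda>x. x * _"] cong: if_cong)
qed

text \<open>As the inverse metric is diagonal, only four Ricci components have to be
  computed.\<close>

lemma alpha_scalar_curvature_diag:
  assumes p: "p \<in> Freund"
  shows "alpha_scalar_curvature \<alpha> p = (\<Sum>j\<in>UNIV. alpha_Ricci \<alpha> j j p / metric_diag p $ j)"
  by (simp add: alpha_scalar_curvature_def inverse_metric_diag[OF p] if_distrib[of "\<lambda>x. x * _"] cong: if_cong)

lemma partial_alpha_Gamma:
  assumes p: "p \<in> Freund"
    and D: "((\<lambda>t. Freund_Gamma ((1 - \<alpha>) / 2) i j m (p + t *\<^sub>R axis l 1)) has_real_derivative D) (at 0)"
  shows "partial l (alpha_Gamma \<alpha> i j m) p = D"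
  by (rule partial_eqI[OF p alpha_Gamma_Freund D])

lemma alpha_scalar_curvature_Freund:
  assumes p: "p \<in> Freund"
  shows "alpha_scalar_curvature \<alpha> p = - 3 * (\<alpha>\<^sup>2 - 1) / 2"
proof -
  define \<kappa> where "\<kappa> = (1 - \<alpha>) / 2"
  define a b c d s where "a = p $ 1" "b = p $ 2" "c = p $ 3" "d = p $ 4" "s = a + c"
  note abcds = this
  have nz: "a \<noteq> 0" "b \<noteq> 0" "c \<noteq> 0" "d \<noteq> 0" "s \<noteq> 0"
    using Freund_pos[OF p] by (auto simp: abcds)
  have eqs: "p $ 1 = a" "p $ 2 = b" "p $ 3 = c" "p $ 4 = d" "a + c = s"
    by (auto simp: abcds)
  have c: "c = s - a" by (simp add: abcds)
  note P = partial_alpha_Gamma[OF p, of \<alpha>, folded \<kappa>_def]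
  have const0: "partial l (alpha_Gamma \<alpha> i j m) p = 0"
    if "\<And>q. Freund_Gamma \<kappa> i j m q = 0" for i j m l
    by (rule P) (simp add: that)
  \<comment> \<open>A diagonal Ricci component with index \<open>j\<close> involves
    \<open>partial i\<close> of the coefficient \<open>j j i\<close> and \<open>partial j\<close> of
    the coefficient \<open>i j i\<close>. For \<open>i = j\<close> the two cancel; listed are the
    remaining ones that are not zero by \<open>const0\<close>.\<close>
  have D: "partial 1 (alpha_Gamma \<alpha> 3 3 1) p = (1 - \<kappa>) / s\<^sup>2"
    "partial 3 (alpha_Gamma \<alpha> 1 1 3) p = (1 - \<kappa>) / s\<^sup>2"
    "partial 1 (alpha_Gamma \<alpha> 4 4 1) p = (\<kappa> - 1) * c\<^sup>2 / (s\<^sup>2 * d\<^sup>2)"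
    "partial 3 (alpha_Gamma \<alpha> 4 4 3) p = (1 - \<kappa>) * a\<^sup>2 / (s\<^sup>2 * d\<^sup>2)"
    "partial 1 (alpha_Gamma \<alpha> 2 2 1) p = (1 - \<kappa>) * c\<^sup>2 / (s\<^sup>2 * b\<^sup>2)"
    "partial 3 (alpha_Gamma \<alpha> 2 2 3) p = (\<kappa> - 1) * a\<^sup>2 / (s\<^sup>2 * b\<^sup>2)"
    "partial 3 (alpha_Gamma \<alpha> 1 3 1) p = \<kappa> / s\<^sup>2"
    "partial 1 (alpha_Gamma \<alpha> 3 1 3) p = \<kappa> / s\<^sup>2"
    "partial 3 (alpha_Gamma \<alpha> 4 3 4) p = \<kappa> / s\<^sup>2"
    "partial 1 (alpha_Gamma \<alpha> 2 1 2) p = \<kappa> / s\<^sup>2"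
    "partial 1 (alpha_Gamma \<alpha> 4 1 4) p = - \<kappa> * c * (s + a) / (a\<^sup>2 * s\<^sup>2)"
    "partial 3 (alpha_Gamma \<alpha> 2 3 2) p = - \<kappa> * a * (s + c) / (c\<^sup>2 * s\<^sup>2)"
    by (rule P, use nz in \<open>auto intro!: derivative_eq_intros simp: Freund_Gamma_def Let_def axis_one_nth eqs;
        (simp add: divide_simps)?; (simp add: c eval_nat_numeral algebra_simps; fail)?\<close>)+
  note G = alpha_Gamma_Freund[OF p, of \<alpha>, folded \<kappa>_def]
  note R = alpha_Ricci_contraction[OF p] alpha_curvature_coord sum_4 D const0 G
    Freund_Gamma_def Let_def eqs
  have "alpha_Ricci \<alpha> 1 1 p = 2 * \<kappa> * (1 - \<kappa>) * c / (a * s\<^sup>2)"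
    by (simp add: R; simp add: nz divide_simps; simp add: c eval_nat_numeral algebra_simps)
  moreover have "alpha_Ricci \<alpha> 2 2 p = 2 * \<kappa> * (1 - \<kappa>) * c / (b\<^sup>2 * s)"
    by (simp add: R; simp add: nz divide_simps; simp add: c eval_nat_numeral algebra_simps)
  moreover have "alpha_Ricci \<alpha> 3 3 p = 2 * \<kappa> * (1 - \<kappa>) * a / (c * s\<^sup>2)"
    by (simp add: R; simp add: nz divide_simps; simp add: c eval_nat_numeral algebra_simps)
  moreover have "alpha_Ricci \<alpha> 4 4 p = 2 * \<kappa> * (1 - \<kappa>) * a / (d\<^sup>2 * s)"
    by (simp add: R; simp add: nz divide_simps; simp add: c eval_nat_numeral algebra_simps)
  \<comment> \<open>Divided by the metric, the four components are
    \<open>2 * \<kappa> * (1 - \<kappa>)\<close> times \<open>c / s\<close>, 1, \<open>a / s\<close>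
    and 1, and these factors sum to 3. Finally
    \<open>\<kappa> * (1 - \<kappa>) = (1 - \<alpha>\<^sup>2) / 4\<close>.\<close>
  ultimately have "alpha_scalar_curvature \<alpha> p = 6 * \<kappa> * (1 - \<kappa>)"
    by (simp add: alpha_scalar_curvature_diag[OF p] sum_4 metric_diag_nth eqs;
        simp add: nz divide_simps; simp add: c eval_nat_numeral algebra_simps)
  then show ?thesis
    by (simp add: \<kappa>_def power2_eq_square field_simps)
qed

subsection \<open>The local isometry\<close>

text \<open>Written as a linear combination of axis vectors so that the standard differentiation and
  continuity rules apply directly.\<close>

definition vec4 :: "real \<Rightarrow> real \<Rightarrow> real \<Rightarrow> real \<Rightarrow> real^4" where
  "vec4 a b c d = a *\<^sub>R axis 1 1 + b *\<^sub>R axis 2 1 + c *\<^sub>R axis 3 1 + d *\<^sub>R axis 4 1"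

lemma vec4_nth [simp]:
  "vec4 a b c d $ 1 = a" "vec4 a b c d $ 2 = b" "vec4 a b c d $ 3 = c" "vec4 a b c d $ 4 = d"
  by (simp_all add: vec4_def axis_one_nth)

lemma inner_real4: "(v :: real^4) \<bullet> w = v $ 1 * w $ 1 + v $ 2 * w $ 2 + v $ 3 * w $ 3 + v $ 4 * w $ 4"
  by (simp add: inner_vec_def sum_4)

lemma fisher_inner_Freund:
  assumes p: "p \<in> Freund"
  shows "fisher_inner p v w = (v $ 1 * w $ 1 / p $ 1 + p $ 3 * v $ 2 * w $ 2 / (p $ 2)\<^sup>2
    + v $ 3 * w $ 3 / p $ 3 + p $ 1 * v $ 4 * w $ 4 / (p $ 4)\<^sup>2) / (p $ 1 + p $ 3)"
proof -
  have "fisher_inner p v w = (\<Sum>i\<in>UNIV. metric_diag p $ i * v $ i * w $ i)"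
    by (simp add: fisher_inner_def fisher_metric_diag[OF p] if_distrib[of "\<lambda>x. x * _"] cong: if_cong)
  then show ?thesis
    using Freund_pos[OF p] by (simp add: sum_4 metric_diag_nth add_divide_distrib)
qed

text \<open>
  Angles are measured from those of the base point \<open>p\<close>, so that around \<open>p\<close> they stay in
  \<open>(- \<pi> / 2, \<pi> / 2)\<close> and can be recovered by \<open>arctan\<close>.
\<close>

definition polar_map :: "real^4 \<Rightarrow> real^4 \<Rightarrow> real \<times> (real^4)" where
  "polar_map p q = (let s = q $ 1 + q $ 3; r = sqrt (q $ 1 / s); \<rho> = sqrt (q $ 3 / s);
     \<phi> = (ln (q $ 4) - ln (p $ 4)) / 2; \<psi> = (ln (q $ 2) - ln (p $ 2)) / 2 in
     (ln s, vec4 (2 * r * cos \<phi>) (2 * r * sin \<phi>) (2 * \<rho> * cos \<psi>) (2 * \<rho> * sin \<psi>)))"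

definition polar_map_deriv :: "real^4 \<Rightarrow> real^4 \<Rightarrow> real^4 \<Rightarrow> real \<times> (real^4)" where
  "polar_map_deriv p q v = (let s = q $ 1 + q $ 3; r = sqrt (q $ 1 / s); \<rho> = sqrt (q $ 3 / s);
     \<phi> = (ln (q $ 4) - ln (p $ 4)) / 2; \<psi> = (ln (q $ 2) - ln (p $ 2)) / 2;
     dr = (q $ 3 * v $ 1 - q $ 1 * v $ 3) / (2 * r * s\<^sup>2);
     d\<rho> = (q $ 1 * v $ 3 - q $ 3 * v $ 1) / (2 * \<rho> * s\<^sup>2);
     d\<phi> = v $ 4 / (2 * q $ 4); d\<psi> = v $ 2 / (2 * q $ 2) in
     ((v $ 1 + v $ 3) / s,
      vec4 (2 * (dr * cos \<phi> - r * d\<phi> * sin \<phi>)) (2 * (dr * sin \<phi> + r * d\<phi> * cos \<phi>))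
       (2 * (d\<rho> * cos \<psi> - \<rho> * d\<psi> * sin \<psi>)) (2 * (d\<rho> * sin \<psi> + \<rho> * d\<psi> * cos \<psi>))))"

section \<open>The derivative of the polar map and the metric it pulls back\<close>

lemma has_derivative_vec4:
  assumes "(f has_derivative f') F" "(g has_derivative g') F" "(h has_derivative h') F" "(k has_derivative k') F"
  shows "((\<lambda>x. vec4 (f x) (g x) (h x) (k x)) has_derivative (\<lambda>x. vec4 (f' x) (g' x) (h' x) (k' x))) F"
  unfolding vec4_def by (intro derivative_intros assms)

lemma continuous_on_vec4:
  assumes "continuous_on S f" "continuous_on S g" "continuous_on S h" "continuous_on S k"
  shows "continuous_on S (\<lambda>x. vec4 (f x) (g x) (h x) (k x))"
  unfolding vec4_def by (intro continuous_intros assms)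

lemma has_derivative_nth: "((\<lambda>q. q $ i) has_derivative (\<lambda>v. v $ i)) (at q)" for q :: "real^'n"
  by (rule bounded_linear_imp_has_derivative[OF bounded_linear_vec_nth])

text \<open>The disjunction for \<open>S\<close> lets one lemma serve both radii: their denominator
  is written \<open>q $ 1 + q $ 3\<close> in either case, while \<open>i\<close> and
  \<open>j\<close> change roles.\<close>

lemma has_derivative_sqrt_fraction:
  fixes q :: "real^'n"
  assumes "0 < q $ i" "0 < q $ j" "S = (\<lambda>q. q $ i + q $ j) \<or> S = (\<lambda>q. q $ j + q $ i)"
  shows "((\<lambda>q. sqrt (q $ i / S q)) has_derivative
    (\<lambda>v. (q $ j * v $ i - q $ i * v $ j) / (2 * sqrt (q $ i / S q) * (S q)\<^sup>2))) (at q)"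
proof -
  have S: "S = (\<lambda>q. q $ i + q $ j)" using assms by (auto simp: add.commute)
  have pos: "0 < q $ i / (q $ i + q $ j)" "q $ i + q $ j \<noteq> 0" using assms by auto
  have "((\<lambda>q. q $ i / (q $ i + q $ j)) has_derivative
      (\<lambda>v. (q $ j * v $ i - q $ i * v $ j) / (q $ i + q $ j)\<^sup>2)) (at q)"
    using pos by (auto intro!: derivative_eq_intros has_derivative_nth
      simp: fun_eq_iff divide_simps power2_eq_square algebra_simps)
  from DERIV_compose_FDERIV[OF DERIV_real_sqrt[OF pos(1)] this] show ?thesis
    unfolding S by (simp add: field_simps)
qed

lemma has_derivative_half_ln:
  fixes q :: "real^'n"
  assumes "0 < q $ i"
  shows "((\<lambda>q. (ln (q $ i) - c) / 2) has_derivative (\<lambda>v. v $ i / (2 * q $ i))) (at q)"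
proof -
  have "((\<lambda>q. ln (q $ i)) has_derivative (\<lambda>v. 1 / q $ i * v $ i)) (at q)"
    using DERIV_compose_FDERIV[OF DERIV_ln_divide[OF assms] has_derivative_nth] by (simp add: mult.commute)
  from has_derivative_mult_right[OF has_derivative_diff[OF this has_derivative_const[of c]], of "1 / 2"]
  show ?thesis by simp
qed

lemma has_derivative_polar:
  fixes r \<phi> :: "'a::real_normed_vector \<Rightarrow> real"
  assumes "(r has_derivative r') (at q)" "(\<phi> has_derivative \<phi>') (at q)"
  shows "((\<lambda>q. 2 * r q * cos (\<phi> q)) has_derivative
      (\<lambda>v. 2 * (r' v * cos (\<phi> q) - r q * \<phi>' v * sin (\<phi> q)))) (at q)"
    and "((\<lambda>q. 2 * r q * sin (\<phi> q)) has_derivative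
      (\<lambda>v. 2 * (r' v * sin (\<phi> q) + r q * \<phi>' v * cos (\<phi> q)))) (at q)"
  by (rule has_derivative_eq_rhs, (rule assms derivative_intros)+, simp add: fun_eq_iff algebra_simps)+

lemma has_derivative_polar_map:
  assumes q: "q \<in> Freund"
  shows "(polar_map p has_derivative polar_map_deriv p q) (at q)"
proof -
  note pos = Freund_pos[OF q]
  note first = has_derivative_polar[OF
      has_derivative_sqrt_fraction[OF pos(1)[of 1] pos(1)[of 3] disjI1[OF refl]]
      has_derivative_half_ln[OF pos(1)[of 4], of "ln (p $ 4)"]]
  note second = has_derivative_polar[OF
      has_derivative_sqrt_fraction[OF pos(1)[of 3] pos(1)[of 1] disjI2[OF refl]]
      has_derivative_half_ln[OF pos(1)[of 2], of "ln (p $ 2)"]]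
  have ln: "((\<lambda>q. ln (q $ 1 + q $ 3)) has_derivative (\<lambda>v. (v $ 1 + v $ 3) / (q $ 1 + q $ 3))) (at q)"
    using pos(3)[of 1 3] by (auto intro!: derivative_eq_intros has_derivative_nth simp: fun_eq_iff field_simps)
  show ?thesis
    unfolding polar_map_def[abs_def] polar_map_deriv_def[abs_def] Let_def
    by (rule has_derivative_Pair[OF ln has_derivative_vec4[OF first second]])
qed

lemma continuous_on_polar_map_deriv:
  "continuous_on Freund (\<lambda>q. polar_map_deriv p q v)"
  unfolding polar_map_deriv_def Let_def
  by (intro continuous_on_Pair continuous_on_vec4 continuous_intros) (auto simp: Freund_pos)

text \<open>Each of the two planes contributes 4 times the polar form of the plane metric, radial
  part plus squared radius times angular part. The angular parts give the metric in the coordinates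
  2 and 4; the radial parts, together with the line factor, give it in the coordinates 1 and
  3.\<close>

lemma inner_polar_map_deriv:
  assumes q: "q \<in> Freund"
  shows "polar_map_deriv p q v \<bullet> polar_map_deriv p q w = fisher_inner q v w"
proof -
  define a c s where "a = q $ 1" "c = q $ 3" "s = q $ 1 + q $ 3"
  note acs = this
  have pos: "0 < a" "0 < c" "0 < s" "q $ 2 \<noteq> 0" "q $ 4 \<noteq> 0"
    using Freund_pos[OF q] by (auto simp: acs)
  define r \<rho> where "r = sqrt (a / s)" "\<rho> = sqrt (c / s)"
  have r: "r \<noteq> 0" "\<rho> \<noteq> 0" "r\<^sup>2 = a / s" "\<rho>\<^sup>2 = c / s"
    using pos by (auto simp: r_\<rho>_def)
  define \<phi> \<psi> where "\<phi> = (ln (q $ 4) - ln (p $ 4)) / 2" "\<psi> = (ln (q $ 2) - ln (p $ 2)) / 2"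
  define dr d\<rho> where "dr u = (c * u $ 1 - a * u $ 3) / (2 * r * s\<^sup>2)"
    "d\<rho> u = (a * u $ 3 - c * u $ 1) / (2 * \<rho> * s\<^sup>2)" for u :: "real^4"
  define d\<phi> d\<psi> where "d\<phi> u = u $ 4 / (2 * q $ 4)" "d\<psi> u = u $ 2 / (2 * q $ 2)" for u :: "real^4"
  \<comment> \<open>Rotation by \<open>t\<close> preserves the inner product, which removes the
    angles from the computation.\<close>
  have rot: "(x * cos t - y * sin t) * (x' * cos t - y' * sin t)
      + (x * sin t + y * cos t) * (x' * sin t + y' * cos t) = x * x' + y * y'" for x y x' y' t :: real
  proof -
    have "(x * cos t - y * sin t) * (x' * cos t - y' * sin t)
      + (x * sin t + y * cos t) * (x' * sin t + y' * cos t) = (x * x' + y * y') * ((sin t)\<^sup>2 + (cos t)\<^sup>2)"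
      by (simp only: power2_eq_square) (simp only: algebra_simps)
    then show ?thesis by (simp only: sin_cos_squared_add mult_1_right)
  qed
  have sc: "2 * x * (2 * y) = 4 * (x * y)" for x y :: real by simp
  have M: "polar_map_deriv p q u = ((u $ 1 + u $ 3) / s,
      vec4 (2 * (dr u * cos \<phi> - r * d\<phi> u * sin \<phi>)) (2 * (dr u * sin \<phi> + r * d\<phi> u * cos \<phi>))
       (2 * (d\<rho> u * cos \<psi> - \<rho> * d\<psi> u * sin \<psi>)) (2 * (d\<rho> u * sin \<psi> + \<rho> * d\<psi> u * cos \<psi>)))" for u
    by (simp only: polar_map_deriv_def Let_def acs r_\<rho>_def \<phi>_\<psi>_def dr_d\<rho>_def d\<phi>_d\<psi>_def)
  have "polar_map_deriv p q v \<bullet> polar_map_deriv p q w =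
      (v $ 1 + v $ 3) / s * ((w $ 1 + w $ 3) / s)
      + 4 * ((dr v * cos \<phi> - r * d\<phi> v * sin \<phi>) * (dr w * cos \<phi> - r * d\<phi> w * sin \<phi>)
         + (dr v * sin \<phi> + r * d\<phi> v * cos \<phi>) * (dr w * sin \<phi> + r * d\<phi> w * cos \<phi>))
      + 4 * ((d\<rho> v * cos \<psi> - \<rho> * d\<psi> v * sin \<psi>) * (d\<rho> w * cos \<psi> - \<rho> * d\<psi> w * sin \<psi>)
         + (d\<rho> v * sin \<psi> + \<rho> * d\<psi> v * cos \<psi>) * (d\<rho> w * sin \<psi> + \<rho> * d\<psi> w * cos \<psi>))"
    by (simp only: M inner_prod_def inner_real4 inner_real_def vec4_nth fst_conv snd_conv sc)
      (simp only: distrib_left[of 4] add.assoc)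
  also have "\<dots> = (v $ 1 + v $ 3) * (w $ 1 + w $ 3) / s\<^sup>2
      + 4 * (dr v * dr w + r\<^sup>2 * (d\<phi> v * d\<phi> w)) + 4 * (d\<rho> v * d\<rho> w + \<rho>\<^sup>2 * (d\<psi> v * d\<psi> w))"
    unfolding rot by (simp add: power2_eq_square)
  also have "4 * (dr v * dr w + r\<^sup>2 * (d\<phi> v * d\<phi> w))
     = (c * v $ 1 - a * v $ 3) * (c * w $ 1 - a * w $ 3) / (a * s^3) + a * v $ 4 * w $ 4 / (s * (q $ 4)\<^sup>2)"
  proof -
    have "4 * (dr v * dr w) = (c * v $ 1 - a * v $ 3) * (c * w $ 1 - a * w $ 3) / (r\<^sup>2 * (s\<^sup>2)\<^sup>2)"
      by (simp add: dr_d\<rho>_def power2_eq_square)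
    moreover have "r\<^sup>2 * (s\<^sup>2)\<^sup>2 = a * s^3" using r pos by (simp add: eval_nat_numeral)
    ultimately show ?thesis using r by (simp add: d\<phi>_d\<psi>_def power2_eq_square algebra_simps)
  qed
  also have "4 * (d\<rho> v * d\<rho> w + \<rho>\<^sup>2 * (d\<psi> v * d\<psi> w))
     = (c * v $ 1 - a * v $ 3) * (c * w $ 1 - a * w $ 3) / (c * s^3) + c * v $ 2 * w $ 2 / (s * (q $ 2)\<^sup>2)"
  proof -
    have "4 * (d\<rho> v * d\<rho> w) = (a * v $ 3 - c * v $ 1) * (a * w $ 3 - c * w $ 1) / (\<rho>\<^sup>2 * (s\<^sup>2)\<^sup>2)"
      by (simp add: dr_d\<rho>_def power2_eq_square)
    also have "\<rho>\<^sup>2 * (s\<^sup>2)\<^sup>2 = c * s^3" using r pos by (simp add: eval_nat_numeral)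
    also have "(a * v $ 3 - c * v $ 1) * (a * w $ 3 - c * w $ 1) = (c * v $ 1 - a * v $ 3) * (c * w $ 1 - a * w $ 3)"
      by (simp add: algebra_simps)
    finally show ?thesis using r by (simp add: d\<phi>_d\<psi>_def power2_eq_square algebra_simps)
  qed
  also have "(v $ 1 + v $ 3) * (w $ 1 + w $ 3) / s\<^sup>2
      + ((c * v $ 1 - a * v $ 3) * (c * w $ 1 - a * w $ 3) / (a * s^3) + a * v $ 4 * w $ 4 / (s * (q $ 4)\<^sup>2))
      + ((c * v $ 1 - a * v $ 3) * (c * w $ 1 - a * w $ 3) / (c * s^3) + c * v $ 2 * w $ 2 / (s * (q $ 2)\<^sup>2))
      = fisher_inner q v w"
  proof -
    have c: "c = s - a" by (simp add: acs)
    \<comment> \<open>Here the differential of \<open>ln s\<close> and the two radial differentials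
      recombine, and the mixed terms in the coordinates 1 and 3 cancel.\<close>
    have "(v $ 1 + v $ 3) * (w $ 1 + w $ 3) / s\<^sup>2
      + (c * v $ 1 - a * v $ 3) * (c * w $ 1 - a * w $ 3) / (a * s^3)
      + (c * v $ 1 - a * v $ 3) * (c * w $ 1 - a * w $ 3) / (c * s^3)
      = v $ 1 * w $ 1 / (a * s) + v $ 3 * w $ 3 / (c * s)"
      using pos by (simp add: divide_simps; simp add: c eval_nat_numeral algebra_simps)
    moreover have "fisher_inner q v w = (v $ 1 * w $ 1 / a + c * v $ 2 * w $ 2 / (q $ 2)\<^sup>2
        + v $ 3 * w $ 3 / c + a * v $ 4 * w $ 4 / (q $ 4)\<^sup>2) / s"
      by (simp only: fisher_inner_Freund[OF q] acs)
    ultimately show ?thesis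
      by (simp add: add_divide_distrib mult.commute)
  qed
  finally show ?thesis .
qed

section \<open>The inverse of the polar map and its domain and range\<close>

definition polar_inv :: "real^4 \<Rightarrow> real \<times> (real^4) \<Rightarrow> real^4" where
  "polar_inv p = (\<lambda>(t, v). vec4 (exp t * ((v $ 1)\<^sup>2 + (v $ 2)\<^sup>2) / 4) (p $ 2 * exp (2 * arctan (v $ 4 / v $ 3)))
     (exp t * ((v $ 3)\<^sup>2 + (v $ 4)\<^sup>2) / 4) (p $ 4 * exp (2 * arctan (v $ 2 / v $ 1))))"

text \<open>The angles are half logarithms of the ratios to the base point, so the bounds by
  \<open>exp (- pi)\<close> and \<open>exp pi\<close> confine them to the interval from
  \<open>- pi / 2\<close> to \<open>pi / 2\<close>.\<close>

definition polar_domain :: "real^4 \<Rightarrow> (real^4) set" where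
  "polar_domain p = {q. 0 < q $ 1 \<and> 0 < q $ 3 \<and> p $ 2 * exp (- pi) < q $ 2 \<and> q $ 2 < p $ 2 * exp pi
     \<and> p $ 4 * exp (- pi) < q $ 4 \<and> q $ 4 < p $ 4 * exp pi}"

text \<open>Positivity of the two cosines: these open half-spaces cut the image of
  \<open>polar_domain p\<close> out of \<open>line_times_sphere\<close>.\<close>

definition polar_range :: "(real \<times> (real^4)) set" where
  "polar_range = {w. 0 < snd w $ 1 \<and> 0 < snd w $ 3}"

lemma mem_line_times_sphere:
  "w \<in> line_times_sphere \<longleftrightarrow> (snd w $ 1)\<^sup>2 + (snd w $ 2)\<^sup>2 + (snd w $ 3)\<^sup>2 + (snd w $ 4)\<^sup>2 = 4"
proof -
  have "norm (snd w) = 2 \<longleftrightarrow> (norm (snd w))\<^sup>2 = 2\<^sup>2"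
    by (simp only: power2_eq_iff_nonneg norm_ge_zero zero_le_numeral)
  then show ?thesis
    by (cases w) (simp add: line_times_sphere_def power2_norm_eq_inner inner_real4 flip: power2_eq_square)
qed

lemma open_polar_domain: "open (polar_domain p)"
  unfolding polar_domain_def by (intro open_Collect_conj open_Collect_less continuous_intros)

lemma open_polar_range: "open polar_range"
  unfolding polar_range_def by (intro open_Collect_conj open_Collect_less continuous_intros)

lemma polar_domain_subset: "p \<in> Freund \<Longrightarrow> polar_domain p \<subseteq> Freund"
proof
  fix q assume p: "p \<in> Freund" and q: "q \<in> polar_domain p"
  have "0 < p $ i * exp (- pi)" for i using Freund_pos(1)[OF p, of i] by simp
  from this[of 2] this[of 4] q show "q \<in> Freund"
    by (auto simp: Freund_def polar_domain_def forall_4)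
qed

lemma half_log_ratio:
  fixes x y :: real
  assumes "0 < x" "0 < y"
  shows "exp (2 * ((ln y - ln x) / 2)) = y / x"
    and "x * exp (- pi) < y \<and> y < x * exp pi \<longleftrightarrow> \<bar>(ln y - ln x) / 2\<bar> < pi / 2"
proof -
  have "2 * ((ln y - ln x) / 2) = ln y - ln x" by simp
  then show "exp (2 * ((ln y - ln x) / 2)) = y / x"
    using assms by (simp only: exp_diff exp_ln)
  have "x * exp (- pi) < y \<longleftrightarrow> ln x - pi < ln y"
    using assms ln_less_cancel_iff[of "x * exp (- pi)" y] by (simp add: ln_mult)
  moreover have "y < x * exp pi \<longleftrightarrow> ln y < ln x + pi"
    using assms ln_less_cancel_iff[of y "x * exp pi"] by (simp add: ln_mult)
  ultimately show "x * exp (- pi) < y \<and> y < x * exp pi \<longleftrightarrow> \<bar>(ln y - ln x) / 2\<bar> < pi / 2"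
    by (auto simp: abs_less_iff)
qed

text \<open>In each plane the squared length is 4 times \<open>q $ 1 / s\<close> or
  \<open>q $ 3 / s\<close>; these add up to 4, and multiplication by \<open>s / 4\<close>, with
  \<open>s\<close> read off the line factor, recovers the parameter. The quotient in each plane is
  the tangent of the angle, inverted by \<open>arctan\<close> on the chosen interval.\<close>

lemma polar_map_domain:
  assumes p: "p \<in> Freund" and q: "q \<in> polar_domain p"
  shows "polar_map p q \<in> line_times_sphere \<inter> polar_range" and "polar_inv p (polar_map p q) = q"
proof -
  have qF: "q \<in> Freund" using polar_domain_subset[OF p] q by blast
  note pos = Freund_pos(1)[OF p] Freund_pos(1)[OF qF]
  define s where "s = q $ 1 + q $ 3"
  define r \<rho> where "r = sqrt (q $ 1 / s)" "\<rho> = sqrt (q $ 3 / s)"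
  have s: "0 < s" using Freund_pos[OF qF] by (simp add: s_def)
  have r: "0 < r" "0 < \<rho>" "r\<^sup>2 = q $ 1 / s" "\<rho>\<^sup>2 = q $ 3 / s"
    using s pos by (auto simp: r_\<rho>_def less_imp_le)
  define \<phi> \<psi> where "\<phi> = (ln (q $ 4) - ln (p $ 4)) / 2" "\<psi> = (ln (q $ 2) - ln (p $ 2)) / 2"
  have \<phi>: "\<bar>\<phi>\<bar> < pi / 2" "\<bar>\<psi>\<bar> < pi / 2"
    using half_log_ratio(2)[of "p $ 4" "q $ 4"] half_log_ratio(2)[of "p $ 2" "q $ 2"] pos q
    by (auto simp: polar_domain_def \<phi>_\<psi>_def)
  have e: "exp (2 * \<phi>) = q $ 4 / p $ 4" "exp (2 * \<psi>) = q $ 2 / p $ 2"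
    unfolding \<phi>_\<psi>_def by (intro half_log_ratio pos)+
  have M: "polar_map p q = (ln s, vec4 (2 * r * cos \<phi>) (2 * r * sin \<phi>) (2 * \<rho> * cos \<psi>) (2 * \<rho> * sin \<psi>))"
    by (simp add: polar_map_def Let_def s_def r_\<rho>_def \<phi>_\<psi>_def)
  have cos: "0 < cos \<phi>" "0 < cos \<psi>" using \<phi> by (auto intro!: cos_gt_zero_pi simp: abs_less_iff)
  have sq: "(2 * u * cos t)\<^sup>2 + (2 * u * sin t)\<^sup>2 = 4 * u\<^sup>2" for u t :: real
  proof -
    have "(2 * u * cos t)\<^sup>2 + (2 * u * sin t)\<^sup>2 = 4 * u\<^sup>2 * ((sin t)\<^sup>2 + (cos t)\<^sup>2)"
      by (simp add: power_mult_distrib distrib_left del: sin_cos_squared_add sin_cos_squared_add2)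
    then show ?thesis by simp
  qed
  have "r\<^sup>2 + \<rho>\<^sup>2 = 1"
    unfolding r add_divide_distrib[symmetric] using s by (simp add: s_def)
  then have "4 * r\<^sup>2 + 4 * \<rho>\<^sup>2 = 4" by simp
  then show "polar_map p q \<in> line_times_sphere \<inter> polar_range"
    using r cos sq[of r \<phi>] sq[of \<rho> \<psi>] by (simp add: M mem_line_times_sphere polar_range_def)
  have "arctan (tan \<phi>) = \<phi>" "arctan (tan \<psi>) = \<psi>"
    by (intro arctan_tan; use \<phi> in \<open>simp add: abs_less_iff\<close>)+
  then have at: "arctan (2 * r * sin \<phi> / (2 * r * cos \<phi>)) = \<phi>"
      "arctan (2 * \<rho> * sin \<psi> / (2 * \<rho> * cos \<psi>)) = \<psi>"
    using r by (simp_all add: tan_def)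
  have "polar_inv p (polar_map p q) = vec4 (q $ 1) (q $ 2) (q $ 3) (q $ 4)"
    unfolding M polar_inv_def prod.case vec4_nth at sq e
    using s Freund_pos(2)[OF p] unfolding r by (simp del: ln_exp)
  then show "polar_inv p (polar_map p q) = q"
    by (simp add: vec_eq_iff forall_4)
qed

text \<open>For positive \<open>x\<close> the angle is \<open>arctan (y / x)\<close> without any
  correction of the branch, and the length is \<open>x\<close> times
  \<open>sqrt (1 + (y / x)\<^sup>2)\<close>, the denominator in the formulas for \<open>cos\<close>
  and \<open>sin\<close> of \<open>arctan\<close>.\<close>

lemma polar_coordinates:
  fixes x y :: real
  assumes "0 < x"
  shows "sqrt (x\<^sup>2 + y\<^sup>2) * cos (arctan (y / x)) = x" "sqrt (x\<^sup>2 + y\<^sup>2) * sin (arctan (y / x)) = y"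
proof -
  have "x\<^sup>2 + y\<^sup>2 = x\<^sup>2 * (1 + (y / x)\<^sup>2)"
    using assms by (simp add: power_divide distrib_left)
  then have "sqrt (x\<^sup>2 + y\<^sup>2) = x * sqrt (1 + (y / x)\<^sup>2)"
    using assms by (simp add: real_sqrt_mult)
  moreover have "sqrt (1 + (y / x)\<^sup>2) \<noteq> 0"
    by (metis power_zero_numeral real_sqrt_eq_zero_cancel_iff zero_neq_one add_nonneg_eq_0_iff zero_le_one zero_le_power2)
  ultimately show "sqrt (x\<^sup>2 + y\<^sup>2) * cos (arctan (y / x)) = x" "sqrt (x\<^sup>2 + y\<^sup>2) * sin (arctan (y / x)) = y"
    using assms by (simp_all add: cos_arctan sin_arctan)
qed

lemma polar_inv_range:
  assumes p: "p \<in> Freund" and w: "w \<in> line_times_sphere \<inter> polar_range"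
  shows "polar_inv p w \<in> polar_domain p" and "polar_map p (polar_inv p w) = w"
proof -
  obtain t v where tv: "w = (t, v)" by (cases w)
  define A B where "A = (v $ 1)\<^sup>2 + (v $ 2)\<^sup>2" "B = (v $ 3)\<^sup>2 + (v $ 4)\<^sup>2"
  have v: "0 < v $ 1" "0 < v $ 3" using w by (auto simp: polar_range_def tv)
  have AB: "A + B = 4" "0 < A" "0 < B"
    using w v by (auto simp: mem_line_times_sphere tv A_B_def add_pos_nonneg)
  note pos = Freund_pos(1)[OF p]
  define \<phi> \<psi> where "\<phi> = arctan (v $ 2 / v $ 1)" "\<psi> = arctan (v $ 4 / v $ 3)"
  have I: "polar_inv p w = vec4 (exp t * A / 4) (p $ 2 * exp (2 * \<psi>)) (exp t * B / 4) (p $ 4 * exp (2 * \<phi>))"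
    by (simp add: polar_inv_def tv A_B_def \<phi>_\<psi>_def)
  have "- pi < 2 * \<phi>" "2 * \<phi> < pi" "- pi < 2 * \<psi>" "2 * \<psi> < pi"
    using arctan_bounded[of "v $ 2 / v $ 1"] arctan_bounded[of "v $ 4 / v $ 3"] by (auto simp: \<phi>_\<psi>_def)
  then show "polar_inv p w \<in> polar_domain p"
    using pos AB by (auto simp: I polar_domain_def)
  \<comment> \<open>The sphere equation \<open>A + B = 4\<close> makes the sum of the coordinates 1
    and 3 equal to \<open>exp t\<close>, so its logarithm returns the line coordinate.\<close>
  have "exp t * A / 4 + exp t * B / 4 = exp t * (A + B) / 4" by (simp add: algebra_simps)
  then have s: "exp t * A / 4 + exp t * B / 4 = exp t" using AB by simp
  have h: "(ln (p $ i * exp (2 * u)) - ln (p $ i)) / 2 = u" for i u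
    using pos[of i] by (simp add: ln_mult less_imp_neq[symmetric])
  have "sqrt (A / 4) = sqrt A / 2" for A by (simp add: real_sqrt_divide)
  then have h2: "2 * sqrt (exp t * A / 4 / exp t) = sqrt A" for A by (simp add: mult.commute)
  show "polar_map p (polar_inv p w) = w"
    unfolding I polar_map_def Let_def vec4_nth s h h2
    using polar_coordinates[OF v(1), of "v $ 2"] polar_coordinates[OF v(2), of "v $ 4"]
    by (simp add: tv vec_eq_iff forall_4 A_B_def \<phi>_\<psi>_def)
qed

lemma Freund_locally_isometric: "Freund_locally_isometric_to line_times_sphere"
  unfolding Freund_locally_isometric_to_def
proof (intro ballI exI conjI allI)
  fix p assume p: "p \<in> Freund"
  show "open (polar_domain p)" by (rule open_polar_domain)
  show "p \<in> polar_domain p"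
    using Freund_pos[OF p] by (simp add: polar_domain_def)
  show sub: "polar_domain p \<subseteq> Freund" by (rule polar_domain_subset[OF p])
  show "inj_on (polar_map p) (polar_domain p)"
    by (rule inj_on_inverseI) (rule polar_map_domain(2)[OF p])
  \<comment> \<open>The two inverse lemmas supply the two inclusions; openness relative to
    \<open>line_times_sphere\<close> then follows from that of \<open>polar_range\<close>, without
    invariance of domain.\<close>
  have "polar_map p ` polar_domain p = line_times_sphere \<inter> polar_range"
    using polar_map_domain[OF p] polar_inv_range[OF p] by (force simp: image_iff)
  then show "openin (top_of_set line_times_sphere) (polar_map p ` polar_domain p)"
    using open_polar_range by (auto simp: openin_open)
  show "continuous_on (polar_domain p) (\<lambda>q. polar_map_deriv p q v)" for v
    by (rule continuous_on_subset[OF continuous_on_polar_map_deriv sub])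
  fix q assume "q \<in> polar_domain p"
  then have q: "q \<in> Freund" using sub by blast
  show "(polar_map p has_derivative polar_map_deriv p q) (at q)"
    by (rule has_derivative_polar_map[OF q])
  show "polar_map_deriv p q v \<bullet> polar_map_deriv p q w = fisher_inner q v w" for v w
    by (rule inner_polar_map_deriv[OF q])
qed

theorem proposition1p6:
  shows "(\<forall>\<alpha>::real. \<forall>p\<in>Freund. alpha_scalar_curvature \<alpha> p = (-3 * (\<alpha>\<^sup>2 - 1)) / 2)
    \<and> (\<forall>p\<in>Freund. alpha_scalar_curvature 0 p = 3 / 2 \<and> 0 < alpha_scalar_curvature 0 p)
    \<and> Freund_locally_isometric_to line_times_sphere"
  using Freund_locally_isometric by (simp add: alpha_scalar_curvature_Freund)

end
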